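(* Let $k\ge 3$ and let $m_1,\dots,m_k\ge 1$ be integers. The complete multipartitioned graph $K_{m_1,\dots,m_k}$ of order $m=m_1+\dots+m_k$ is neither positively nor negatively pseudo-invertible. If $k<m$, then its adjacency matrix $A$ is singular.
   Context: $K_{m_1,\dots,m_k}$ is the complete multipartite graph with parts of sizes $m_1,\dots,m_k$. For a real symmetric matrix $A$, $A^\dagger$ denotes its Moore-Penrose inverse. $A^\dagger$ is called positively (negatively) signable if there exists a diagonal matrix $D$ with diagonal entries in $\{+1,-1\}$ such that all entries of $DA^\dagger D$ are non-negative (non-positive). A graph with adjacency matrix $A$ is called positively (negatively) pseudo-invertible if $A^\dagger$ is positively (negatively) signable. *)

theory Defs
  imports "HOL-Analysis.Analysis"
begin

text \<open>
  A graph is given by its adjacency relation (symmetric and irreflexive) on a finite type of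
  vertices, which is also the index type of its adjacency matrix; the order of the graph is the
  cardinality of that type.
\<close>

definition adjacency_matrix :: "('v::finite \<Rightarrow> 'v \<Rightarrow> bool) \<Rightarrow> real ^ 'v ^ 'v" where
  "adjacency_matrix E = (\<chi> i j. if E i j then 1 else 0)"

text \<open>
  \<open>E\<close> is a copy of the complete multipartite graph with parts \<open>1, \<dots>, k\<close> of sizes
  \<open>m 1, \<dots>, m k\<close>; the witness \<open>p\<close> maps each vertex to its part.
\<close>

definition complete_multipartite ::
    "nat \<Rightarrow> (nat \<Rightarrow> nat) \<Rightarrow> ('v::finite \<Rightarrow> 'v \<Rightarrow> bool) \<Rightarrow> bool" where
  "complete_multipartite k m E \<longleftrightarrow>
     (\<exists>p. (\<forall>v. p v \<in> {1..k}) \<and>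
          (\<forall>i\<in>{1..k}. card {v. p v = i} = m i) \<and>
          (\<forall>u v. E u v \<longleftrightarrow> p u \<noteq> p v))"

definition is_moore_penrose :: "real ^ 'n ^ 'm \<Rightarrow> real ^ 'm ^ 'n \<Rightarrow> bool" where
  "is_moore_penrose A X \<longleftrightarrow>
     A ** X ** A = A \<and> X ** A ** X = X \<and>
     transpose (A ** X) = A ** X \<and> transpose (X ** A) = X ** A"

definition moore_penrose :: "real ^ 'n ^ 'm \<Rightarrow> real ^ 'm ^ 'n" where
  "moore_penrose A = (THE X. is_moore_penrose A X)"

definition signature_matrix :: "real ^ 'n ^ 'n \<Rightarrow> bool" where
  "signature_matrix D \<longleftrightarrow>
     (\<forall>i j. i \<noteq> j \<longrightarrow> D $ i $ j = 0) \<and> (\<forall>i. D $ i $ i \<in> {1, -1})"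

definition positively_signable :: "real ^ 'n ^ 'n \<Rightarrow> bool" where
  "positively_signable B \<longleftrightarrow>
     (\<exists>D. signature_matrix D \<and> (\<forall>i j. (D ** B ** D) $ i $ j \<ge> 0))"

definition negatively_signable :: "real ^ 'n ^ 'n \<Rightarrow> bool" where
  "negatively_signable B \<longleftrightarrow>
     (\<exists>D. signature_matrix D \<and> (\<forall>i j. (D ** B ** D) $ i $ j \<le> 0))"

definition positively_pseudo_invertible :: "('v::finite \<Rightarrow> 'v \<Rightarrow> bool) \<Rightarrow> bool" where
  "positively_pseudo_invertible E \<longleftrightarrow>
     positively_signable (moore_penrose (adjacency_matrix E))"

definition negatively_pseudo_invertible :: "('v::finite \<Rightarrow> 'v \<Rightarrow> bool) \<Rightarrow> bool" where
  "negatively_pseudo_invertible E \<longleftrightarrow>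
     negatively_signable (moore_penrose (adjacency_matrix E))"

lemma complete_multipartite_graph:
  assumes "complete_multipartite k m E"
  shows "symp E" "irreflp E"
  using assms by (auto simp: complete_multipartite_def symp_def irreflp_def)

lemma complete_multipartite_order:
  fixes E :: "'v::finite \<Rightarrow> 'v \<Rightarrow> bool"
  assumes "complete_multipartite k m E"
  shows "CARD('v) = (\<Sum>i\<in>{1..k}. m i)"
proof -
  obtain p :: "'v \<Rightarrow> nat" where p: "\<And>v. p v \<in> {1..k}"
    "\<And>i. i \<in> {1..k} \<Longrightarrow> card {v. p v = i} = m i"
    using assms unfolding complete_multipartite_def by metis
  have "(UNIV :: 'v set) = (\<Union>i\<in>{1..k}. {v. p v = i})"
    using p(1) by auto
  then have "CARD('v) = card (\<Union>i\<in>{1..k}. {v. p v = i})"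
    by simp
  also have "\<dots> = (\<Sum>i\<in>{1..k}. card {v. p v = i})"
    by (rule card_UN_disjoint) auto
  finally show ?thesis
    using p(2) by simp
qed

lemma complete_multipartite_exists:
  assumes "CARD('v::finite) = (\<Sum>i\<in>{1..k}. m i)"
  shows "\<exists>E :: 'v \<Rightarrow> 'v \<Rightarrow> bool. complete_multipartite k m E"
proof -
  let ?S = "SIGMA i:{1..k}. {..<m i}"
  have "card ?S = CARD('v)"
    using assms by simp
  then obtain f :: "'v \<Rightarrow> nat \<times> nat" where f: "bij_betw f UNIV ?S"
    by (metis finite_SigmaI finite_atLeastAtMost finite_lessThan finite_class.finite_UNIV
        finite_same_card_bij)
  have "card {v. fst (f v) = i} = m i" if "i \<in> {1..k}" for i
  proof -
    have "f ` {v. fst (f v) = i} = {i} \<times> {..<m i}"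
    proof
      show "f ` {v. fst (f v) = i} \<subseteq> {i} \<times> {..<m i}"
      proof (rule image_subsetI)
        fix v
        assume "v \<in> {v. fst (f v) = i}"
        moreover have "f v \<in> ?S"
          using f by (auto simp: bij_betw_def)
        ultimately show "f v \<in> {i} \<times> {..<m i}"
          by (cases "f v") auto
      qed
      show "{i} \<times> {..<m i} \<subseteq> f ` {v. fst (f v) = i}"
      proof
        fix y
        assume y: "y \<in> {i} \<times> {..<m i}"
        then have "y \<in> ?S"
          using that by auto
        then have "y \<in> range f"
          using f by (simp add: bij_betw_def)
        then obtain v where "y = f v" by blast
        with y show "y \<in> f ` {v. fst (f v) = i}" by auto
      qed
    qed
    moreover have "inj_on f {v. fst (f v) = i}"
      using f by (auto simp: bij_betw_def inj_on_def)
    ultimately show ?thesis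
      by (metis card_image card_cartesian_product_singleton card_lessThan)
  qed
  moreover have "fst (f v) \<in> {1..k}" for v
  proof -
    have "f v \<in> ?S"
      using f by (auto simp: bij_betw_def)
    then show ?thesis
      by (cases "f v") auto
  qed
  ultimately have "complete_multipartite k m (\<lambda>u v. fst (f u) \<noteq> fst (f v))"
    unfolding complete_multipartite_def by (intro exI[of _ "fst \<circ> f"]) auto
  then show ?thesis by blast
qed

lemma is_moore_penrose_unique:
  assumes "is_moore_penrose A X" "is_moore_penrose A Y"
  shows "X = Y"
proof -
  have X: "A ** X ** A = A" "X ** A ** X = X"
    "transpose (A ** X) = A ** X" "transpose (X ** A) = X ** A"
    and Y: "A ** Y ** A = A" "Y ** A ** Y = Y"
    "transpose (A ** Y) = A ** Y" "transpose (Y ** A) = Y ** A"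
    using assms by (auto simp: is_moore_penrose_def)
  have "A ** X = transpose (A ** Y ** (A ** X))"
    using X(3) Y(1) by (simp add: matrix_mul_assoc)
  also have "\<dots> = A ** X ** (A ** Y)"
    using X(3) Y(3) by (simp add: matrix_transpose_mul)
  also have "\<dots> = A ** Y"
    using X(1) by (simp add: matrix_mul_assoc)
  finally have AX: "A ** X = A ** Y" .
  have "X ** A = transpose (X ** A ** (Y ** A))"
    using X(4) Y(1) by (metis matrix_mul_assoc)
  also have "\<dots> = Y ** A ** (X ** A)"
    using X(4) Y(4) by (simp add: matrix_transpose_mul)
  also have "\<dots> = Y ** A"
    using X(1) by (metis matrix_mul_assoc)
  finally have XA: "X ** A = Y ** A" .
  show ?thesis
    using AX XA X(2) Y(2) by (metis matrix_mul_assoc)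
qed

lemma normal_equation_solvable:
  fixes A :: "real ^ 'n ^ 'm"
  shows "\<exists>C. transpose A ** A ** C = transpose A"
proof -
  have sol: "\<exists>x. transpose A *v (A *v x) = transpose A *v b" for b
  proof -
    have sub: "span (range ((*v) A)) = range ((*v) A)"
      by (metis subspace_UNIV linear_subspace_image matrix_vector_mul_linear span_eq_iff)
    obtain y z where yz: "y \<in> span (range ((*v) A))"
      "\<And>w. w \<in> span (range ((*v) A)) \<Longrightarrow> orthogonal z w" "b = y + z"
      by (rule orthogonal_subspace_decomp_exists[of "range ((*v) A)" b]) blast
    obtain x where x: "y = A *v x"
      using yz(1) sub by auto
    have "(transpose A *v z) \<bullet> w = 0" for w
      using yz(2)[of "A *v w"] sub
      by (simp add: orthogonal_def dot_lmul_matrix)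
    then have "transpose A *v z = 0"
      by (metis inner_eq_zero_iff)
    then have "transpose A *v b = transpose A *v (A *v x)"
      using yz(3) x by (simp add: matrix_vector_right_distrib)
    then show ?thesis by metis
  qed
  then obtain f where f: "\<And>b. transpose A *v (A *v f b) = transpose A *v b"
    by metis
  define C :: "real ^ 'm ^ 'n" where "C = (\<chi> i j. f (axis j 1) $ i)"
  have "(transpose A ** A ** C) $ i $ j = transpose A $ i $ j" for i j
  proof -
    have "column j C = f (axis j 1)"
      by (simp add: C_def column_def vec_eq_iff)
    then have "C *v axis j 1 = f (axis j 1)"
      by (simp add: matrix_vector_mult_basis)
    then have "(transpose A ** A ** C) *v axis j 1 = transpose A *v axis j 1"
      using f by (simp add: matrix_vector_mul_assoc[symmetric])
    then show ?thesis
      by (simp add: matrix_vector_mult_basis column_def vec_eq_iff)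
  qed
  then show ?thesis
    by (auto simp: vec_eq_iff)
qed

lemma is_moore_penrose_exists:
  fixes A :: "real ^ 'n ^ 'm"
  shows "\<exists>X. is_moore_penrose A X"
proof -
  have half: "\<exists>C. B ** C ** B = B \<and> transpose (B ** C) = B ** C"
    for B :: "real ^ 'a ^ 'b"
  proof -
    obtain C where C: "transpose B ** B ** C = transpose B"
      using normal_equation_solvable by blast
    have "transpose C ** (transpose B ** B ** C) = transpose (B ** C)"
      using C by (simp add: matrix_transpose_mul)
    then have eq: "transpose (B ** C) ** (B ** C) = transpose (B ** C)"
      by (simp add: matrix_transpose_mul matrix_mul_assoc)
    then have sym: "transpose (B ** C) = B ** C"
      by (metis matrix_transpose_mul transpose_transpose)
    have "B ** C ** B = transpose (transpose B ** (B ** C))"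
      by (metis matrix_transpose_mul sym transpose_transpose)
    then have "B ** C ** B = B"
      using C by (simp add: matrix_mul_assoc)
    with sym show ?thesis by blast
  qed
  obtain C where C: "A ** C ** A = A" "transpose (A ** C) = A ** C"
    using half by blast
  obtain F where F: "transpose A ** F ** transpose A = transpose A"
    "transpose (transpose A ** F) = transpose A ** F"
    using half by blast
  define D where "D = transpose F"
  have D: "A ** D ** A = A" "transpose (D ** A) = D ** A"
    using F unfolding D_def
    by (metis matrix_transpose_mul matrix_mul_assoc transpose_transpose)+
  have "A ** (D ** A ** C) = A ** C" "D ** A ** C ** A = D ** A"
    using C(1) D(1) by (metis matrix_mul_assoc)+
  moreover from this have "D ** A ** C ** A ** (D ** A ** C) = D ** A ** C"
    using D(1) by (metis matrix_mul_assoc)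
  ultimately have "is_moore_penrose A (D ** A ** C)"
    using C D by (simp add: is_moore_penrose_def)
  then show ?thesis ..
qed

lemma is_moore_penrose_moore_penrose: "is_moore_penrose A (moore_penrose A)"
  unfolding moore_penrose_def
  by (rule theI') (blast intro: is_moore_penrose_exists is_moore_penrose_unique)

lemma moore_penrose_eqI: "is_moore_penrose A X \<Longrightarrow> moore_penrose A = X"
  using is_moore_penrose_moore_penrose is_moore_penrose_unique by blast

end

theory Submission
  imports Defs
begin

text \<open>
  Let \<open>p\<close> assign to each vertex its part, let \<open>n\<^sub>i\<close> be the size of the part \<open>i\<close>, and let \<open>k\<close> be
  the number of parts. With \<open>S\<close> the vertex-part incidence matrix, the adjacency matrix is
  \<open>A = S (J - I) S\<^sup>T\<close>, where \<open>S\<^sup>T S = N\<close> is the diagonal matrix of the part sizes. For \<open>k \<ge> 2\<close> the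
  quotient \<open>J - I\<close> is invertible with inverse \<open>J / (k - 1) - I\<close>, so that
  \<open>X = S N\<^sup>-\<^sup>1 (J / (k - 1) - I) N\<^sup>-\<^sup>1 S\<^sup>T\<close> makes both \<open>A X\<close> and \<open>X A\<close> equal to \<open>S N\<^sup>-\<^sup>1 S\<^sup>T\<close>, the
  orthogonal projection onto the vectors that are constant on the parts. Hence \<open>X\<close> is the
  Moore-Penrose inverse of \<open>A\<close>.

  For \<open>k \<ge> 3\<close> the entries of \<open>X\<close> are negative inside a part and positive between different parts.
  Conjugation by a signature matrix preserves the diagonal, so the negative diagonal entries exclude
  positive signability. Conjugation also preserves the product of the entries along a triangle, and
  the three entries between vertices of three different parts have a positive product; this excludes
  negative signability. If some part has two vertices, their rows in \<open>A\<close> coincide and \<open>A\<close> is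
  singular.
\<close>

section \<open>The pseudo-inverse of a complete multipartite graph\<close>

definition part_size :: "('v::finite \<Rightarrow> 'i) \<Rightarrow> 'i \<Rightarrow> real" where
  "part_size p i = real (card {v. p v = i})"

text \<open>The orthogonal projection \<open>S N\<^sup>-\<^sup>1 S\<^sup>T\<close>: it averages a vector over each part.\<close>

definition part_averaging :: "('v::finite \<Rightarrow> 'i) \<Rightarrow> real ^ 'v ^ 'v" where
  "part_averaging p = (\<chi> u v. of_bool (p u = p v) / part_size p (p v))"

text \<open>The matrix \<open>S N\<^sup>-\<^sup>1 (J / (k - 1) - I) N\<^sup>-\<^sup>1 S\<^sup>T\<close>, where \<open>k\<close> is the number of parts.\<close>

definition multipartite_pinv :: "('v::finite \<Rightarrow> 'i) \<Rightarrow> real ^ 'v ^ 'v" where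
  "multipartite_pinv p =
     (\<chi> u v. (1 / (real (card (range p)) - 1) - of_bool (p u = p v)) /
              (part_size p (p u) * part_size p (p v)))"

lemma part_size_pos: "part_size p (p v) > 0"
  by (auto simp: part_size_def card_gt_0_iff)

text \<open>
  This is the identity \<open>S\<^sup>T S = N\<close> in coordinates: it moves a matrix product over the vertices to the
  quotient, where the index runs over the parts.
\<close>

lemma sum_div_part_size:
  fixes f :: "'i \<Rightarrow> real" and p :: "'v::finite \<Rightarrow> 'i"
  shows "(\<Sum>v\<in>UNIV. f (p v) / part_size p (p v)) = (\<Sum>i\<in>range p. f i)"
proof -
  have "(\<Sum>v\<in>UNIV. f (p v) / part_size p (p v)) =
      (\<Sum>i\<in>range p. \<Sum>v\<in>{v. p v = i}. f (p v) / part_size p (p v))"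
    using sum.image_gen[of UNIV "\<lambda>v. f (p v) / part_size p (p v)" p] by simp
  also have "\<dots> = (\<Sum>i\<in>range p. f i)"
  proof (rule sum.cong[OF refl])
    fix i assume "i \<in> range p"
    then have "part_size p i > 0" using part_size_pos by (metis imageE)
    moreover have "(\<Sum>v\<in>{v. p v = i}. f (p v) / part_size p (p v)) =
        part_size p i * (f i / part_size p i)"
      by (simp add: part_size_def)
    ultimately show "(\<Sum>v\<in>{v. p v = i}. f (p v) / part_size p (p v)) = f i"
      by simp
  qed
  finally show ?thesis .
qed

lemma transpose_multipartite_pinv: "transpose (multipartite_pinv p) = multipartite_pinv p"
  by (auto simp: multipartite_pinv_def transpose_def vec_eq_iff mult.commute)

lemma transpose_part_averaging: "transpose (part_averaging p) = part_averaging p"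
  by (auto simp: part_averaging_def transpose_def vec_eq_iff)

lemma transpose_multipartite_adjacency:
  "transpose (adjacency_matrix (\<lambda>u v. p u \<noteq> p v)) = adjacency_matrix (\<lambda>u v. p u \<noteq> p v)"
  by (auto simp: adjacency_matrix_def transpose_def vec_eq_iff)

text \<open>
  In the quotient this is \<open>(J - I) (J / (k - 1) - I) = I\<close>: the product of \<open>i \<mapsto> [i \<noteq> p u]\<close> with
  \<open>i \<mapsto> 1 / (k - 1) - [i = p w]\<close>, summed over the \<open>k\<close> parts, is \<open>1 - [p u \<noteq> p w]\<close>.
\<close>

lemma adjacency_mult_pinv:
  fixes p :: "'v::finite \<Rightarrow> 'i"
  assumes "card (range p) \<ge> 2"
  shows "adjacency_matrix (\<lambda>u v. p u \<noteq> p v) ** multipartite_pinv p = part_averaging p"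
proof -
  define c where "c = 1 / (real (card (range p)) - 1)"
  have c: "(real (card (range p)) - 1) * c = 1"
    using assms by (simp add: c_def)
  have "(adjacency_matrix (\<lambda>u v. p u \<noteq> p v) ** multipartite_pinv p) $ u $ w =
      part_averaging p $ u $ w" for u w
  proof -
    have "(adjacency_matrix (\<lambda>u v. p u \<noteq> p v) ** multipartite_pinv p) $ u $ w =
        (\<Sum>v\<in>UNIV. (of_bool (p u \<noteq> p v) * (c - of_bool (p v = p w)) / part_size p (p w)) /
                  part_size p (p v))"
      by (auto simp: matrix_matrix_mult_def adjacency_matrix_def multipartite_pinv_def c_def
          mult.commute intro!: sum.cong)
    also have "\<dots> = (\<Sum>i\<in>range p. of_bool (p u \<noteq> i) * (c - of_bool (i = p w)) / part_size p (p w))"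
      by (rule sum_div_part_size)
    also have "\<dots> = (\<Sum>i\<in>range p. of_bool (p u \<noteq> i) * (c - of_bool (i = p w))) / part_size p (p w)"
      by (rule sum_divide_distrib[symmetric])
    also have "(\<Sum>i\<in>range p. of_bool (p u \<noteq> i) * (c - of_bool (i = p w))) =
        (\<Sum>i\<in>range p - {p u}. c - (if i = p w then 1 else 0))"
      by (intro sum.mono_neutral_cong_right) auto
    also have "\<dots> = (real (card (range p)) - 1) * c - of_bool (p u \<noteq> p w)"
      using assms by (auto simp: sum_subtractf sum.delta of_nat_diff)
    also have "\<dots> = of_bool (p u = p w)"
      using c by simp
    finally show ?thesis
      by (simp add: part_averaging_def)
  qed
  then show ?thesis by (simp add: vec_eq_iff)
qed

lemma pinv_mult_adjacency:
  assumes "card (range p) \<ge> 2"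
  shows "multipartite_pinv p ** adjacency_matrix (\<lambda>u v. p u \<noteq> p v) = part_averaging p"
  using arg_cong[OF adjacency_mult_pinv[OF assms], of transpose]
  by (simp add: matrix_transpose_mul transpose_multipartite_pinv transpose_part_averaging
      transpose_multipartite_adjacency)

text \<open>
  A projection fixes its range. The adjacency matrix and \<open>X\<close> have columns constant on the parts, so
  this gives the equations \<open>A X A = A\<close> and \<open>X A X = X\<close>.
\<close>

lemma part_averaging_mult:
  fixes p :: "'v::finite \<Rightarrow> 'i"
  assumes "\<And>u v. B $ u $ v = g (p u) v"
  shows "part_averaging p ** B = B"
proof -
  have "(part_averaging p ** B) $ u $ w = B $ u $ w" for u w
  proof -
    have "(part_averaging p ** B) $ u $ w =
        (\<Sum>v\<in>UNIV. (of_bool (p u = p v) * g (p v) w) / part_size p (p v))"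
      by (simp add: matrix_matrix_mult_def part_averaging_def assms)
    also have "\<dots> = (\<Sum>i\<in>range p. of_bool (p u = i) * g i w)"
      by (rule sum_div_part_size)
    also have "\<dots> = (\<Sum>i\<in>{p u}. of_bool (p u = i) * g i w)"
      by (rule sum.mono_neutral_right) auto
    also have "\<dots> = B $ u $ w"
      by (simp add: assms)
    finally show ?thesis .
  qed
  then show ?thesis by (simp add: vec_eq_iff)
qed

lemma moore_penrose_multipartite:
  assumes "card (range p) \<ge> 2"
  shows "moore_penrose (adjacency_matrix (\<lambda>u v. p u \<noteq> p v)) = multipartite_pinv p"
proof (rule moore_penrose_eqI)
  have "part_averaging p ** adjacency_matrix (\<lambda>u v. p u \<noteq> p v) =
      adjacency_matrix (\<lambda>u v. p u \<noteq> p v)"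
    by (rule part_averaging_mult[where g = "\<lambda>i v. if i \<noteq> p v then 1 else 0"])
      (simp add: adjacency_matrix_def)
  moreover have "part_averaging p ** multipartite_pinv p = multipartite_pinv p"
    by (rule part_averaging_mult[where g = "\<lambda>i v.
          (1 / (real (card (range p)) - 1) - of_bool (i = p v)) /
          (part_size p i * part_size p (p v))"])
      (simp add: multipartite_pinv_def)
  ultimately show "is_moore_penrose (adjacency_matrix (\<lambda>u v. p u \<noteq> p v)) (multipartite_pinv p)"
    by (simp add: is_moore_penrose_def adjacency_mult_pinv[OF assms] pinv_mult_adjacency[OF assms]
        transpose_part_averaging)
qed

text \<open>The sign is that of \<open>1 / (k - 1) - 1\<close>, which still vanishes for \<open>k = 2\<close>.\<close>

lemma multipartite_pinv_diag_neg:
  assumes "card (range p) \<ge> 3"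
  shows "multipartite_pinv p $ v $ v < 0"
  using assms part_size_pos[of p v]
  by (auto simp: multipartite_pinv_def divide_less_0_iff)

lemma multipartite_pinv_off_part_pos:
  assumes "card (range p) \<ge> 2" "p u \<noteq> p v"
  shows "multipartite_pinv p $ u $ v > 0"
  using assms part_size_pos[of p u] part_size_pos[of p v]
  by (simp add: multipartite_pinv_def)

section \<open>Obstructions to signability\<close>

lemma signature_conjugate_entry:
  assumes "signature_matrix D"
  shows "(D ** B ** D) $ i $ j = D $ i $ i * B $ i $ j * D $ j $ j"
proof -
  have D: "D $ a $ b = 0" if "a \<noteq> b" for a b
    using assms that by (simp add: signature_matrix_def)
  have DB: "(D ** B) $ i $ l = D $ i $ i * B $ i $ l" for l
  proof -
    have "(D ** B) $ i $ l = (\<Sum>a\<in>UNIV. D $ i $ a * B $ a $ l)"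
      by (simp add: matrix_matrix_mult_def)
    also have "\<dots> = (\<Sum>a\<in>{i}. D $ i $ a * B $ a $ l)"
      by (rule sum.mono_neutral_right) (auto simp: D)
    finally show ?thesis by simp
  qed
  have "(D ** B ** D) $ i $ j = (\<Sum>l\<in>UNIV. (D ** B) $ i $ l * D $ l $ j)"
    by (simp add: matrix_matrix_mult_def)
  also have "\<dots> = (\<Sum>l\<in>{j}. (D ** B) $ i $ l * D $ l $ j)"
    by (rule sum.mono_neutral_right) (auto simp: D)
  finally show ?thesis by (simp add: DB)
qed

lemma signature_square:
  assumes "signature_matrix D"
  shows "D $ i $ i * D $ i $ i = 1"
proof -
  have "D $ i $ i \<in> {1, -1}"
    using assms by (simp add: signature_matrix_def)
  then show ?thesis by auto
qed

lemma positively_signable_diag_nonneg: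
  assumes "positively_signable B"
  shows "B $ i $ i \<ge> 0"
proof -
  obtain D where D: "signature_matrix D" and pos: "(D ** B ** D) $ i $ i \<ge> 0"
    using assms unfolding positively_signable_def by blast
  have "(D ** B ** D) $ i $ i = (D $ i $ i * D $ i $ i) * B $ i $ i"
    by (simp add: signature_conjugate_entry[OF D])
  then show ?thesis using pos signature_square[OF D] by simp
qed

text \<open>
  Each sign of \<open>D\<close> occurs twice along a closed walk, so the product over a triangle survives
  conjugation; it consists of three factors, hence is non-positive when all of them are.
\<close>

lemma negatively_signable_triangle_nonpos:
  assumes "negatively_signable B"
  shows "B $ u $ v * B $ v $ w * B $ w $ u \<le> 0"
proof -
  obtain D where D: "signature_matrix D" and neg: "\<And>i j. (D ** B ** D) $ i $ j \<le> 0"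
    using assms unfolding negatively_signable_def by blast
  let ?C = "D ** B ** D"
  have "?C $ u $ v * ?C $ v $ w * ?C $ w $ u =
      (D $ u $ u * D $ u $ u) * (D $ v $ v * D $ v $ v) * (D $ w $ w * D $ w $ w) *
      (B $ u $ v * B $ v $ w * B $ w $ u)"
    by (simp only: signature_conjugate_entry[OF D] mult_ac)
  then have "?C $ u $ v * ?C $ v $ w * ?C $ w $ u = B $ u $ v * B $ v $ w * B $ w $ u"
    by (simp only: signature_square[OF D] mult_1)
  moreover have "?C $ u $ v * ?C $ v $ w * ?C $ w $ u \<le> 0"
    by (intro mult_nonneg_nonpos mult_nonpos_nonpos neg)
  ultimately show ?thesis by simp
qed

section \<open>Complete multipartite graphs with at least three parts\<close>

lemma multipartite_adjacency_singular:
  fixes p :: "'v::finite \<Rightarrow> 'i"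
  assumes "\<not> inj p"
  shows "\<not> invertible (adjacency_matrix (\<lambda>u v. p u \<noteq> p v))"
proof -
  obtain u v where "u \<noteq> v" "p u = p v"
    using assms by (auto simp: inj_def)
  then have "det (adjacency_matrix (\<lambda>u v. p u \<noteq> p v)) = 0"
    by (intro det_identical_rows[of u v]) (auto simp: row_def adjacency_matrix_def)
  then show ?thesis by (simp add: invertible_det_nz)
qed

theorem proposition2p9:
  fixes k :: nat and m :: "nat \<Rightarrow> nat" and E :: "'v::finite \<Rightarrow> 'v \<Rightarrow> bool"
  assumes "k \<ge> 3"
    and "\<And>i. i \<in> {1..k} \<Longrightarrow> m i \<ge> 1"
    and "complete_multipartite k m E"
  shows "\<not> positively_pseudo_invertible E \<and>
         \<not> negatively_pseudo_invertible E \<and>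
         (k < (\<Sum>i\<in>{1..k}. m i) \<longrightarrow> \<not> invertible (adjacency_matrix E))"
proof -
  obtain p :: "'v \<Rightarrow> nat" where p: "\<And>v. p v \<in> {1..k}"
    and size: "\<And>i. i \<in> {1..k} \<Longrightarrow> card {v. p v = i} = m i"
    and E: "\<And>u v. E u v \<longleftrightarrow> p u \<noteq> p v"
    using assms(3) unfolding complete_multipartite_def by metis
  have E: "E = (\<lambda>u v. p u \<noteq> p v)"
    using E by (intro ext) simp
  have nonempty: "\<exists>v. p v = i" if "i \<in> {1..k}" for i
  proof -
    have "card {v. p v = i} \<noteq> 0"
      using assms(2)[OF that] size[OF that] by simp
    then show ?thesis by (auto simp: card_eq_0_iff)
  qed
  have range: "range p = {1..k}"
    using p nonempty by (auto simp: image_iff) metis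
  have k: "card (range p) = k"
    by (simp add: range)
  have pinv: "moore_penrose (adjacency_matrix E) = multipartite_pinv p"
    unfolding E by (rule moore_penrose_multipartite) (use k assms(1) in simp)
  obtain u v w where uvw: "p u = 1" "p v = 2" "p w = 3"
    using nonempty[of 1] nonempty[of 2] nonempty[of 3] assms(1) by auto
  have "\<not> positively_pseudo_invertible E"
    using positively_signable_diag_nonneg[of "multipartite_pinv p" u]
      multipartite_pinv_diag_neg[of p u] k assms(1)
    by (auto simp: positively_pseudo_invertible_def pinv)
  moreover have "\<not> negatively_pseudo_invertible E"
  proof
    assume "negatively_pseudo_invertible E"
    then have "multipartite_pinv p $ u $ v * multipartite_pinv p $ v $ w *
        multipartite_pinv p $ w $ u \<le> 0"
      by (intro negatively_signable_triangle_nonpos)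
        (simp add: negatively_pseudo_invertible_def pinv)
    moreover have "multipartite_pinv p $ u $ v * multipartite_pinv p $ v $ w *
        multipartite_pinv p $ w $ u > 0"
      by (intro mult_pos_pos multipartite_pinv_off_part_pos) (use k assms(1) uvw in auto)
    ultimately show False by simp
  qed
  moreover have "\<not> invertible (adjacency_matrix E)" if "k < (\<Sum>i\<in>{1..k}. m i)"
  proof -
    have "card (range p) < CARD('v)"
      using that k complete_multipartite_order[OF assms(3)] by simp
    then have "\<not> inj p"
      using card_image[of p UNIV] by auto
    then show ?thesis
      unfolding E by (rule multipartite_adjacency_singular)
  qed
  ultimately show ?thesis by blast
qed

end
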